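(* Let $(x_n)_{n\ge 1}$ be a nonincreasing sequence of positive real numbers such that $\sum_{n} x_n = +\infty$, $\lim_{n\to\infty} x_n = 0$, and $$\liminf_{n\to\infty} \frac{x_{n+1}}{x_n} > \frac12 .$$ Then for each real $\ell>0$ there exists a subsequence $(x_{n_k})_{k\ge 1}$ such that $\sum_{k} x_{n_k}=\ell$ and $\sum_{k} x_{n_k}^{\alpha}<\infty$ for all real $\alpha>0$.
   Context: A subsequence $(x_{n_k})_{k\ge1}$ is given by a strictly increasing infinite sequence of indices $n_1<n_2<\cdots$. *)

theory Defs
  imports "HOL-Analysis.Analysis"
begin

end

theory Submission imports Defs begin

text \<open>
  The subsequence is chosen greedily: run through the indices in order and keep a term whenever it
  is strictly smaller than the part of \<open>l\<close> that remains to be represented. The remainder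
  \<open>t\<close> then stays positive, and divergence of the series forces some index to be skipped,
  that is, \<open>t\<^sub>n \<le> x\<^sub>n\<close> for some \<open>n\<close>.

  Let \<open>c > 1/2\<close> be an eventual lower bound for the ratios; dropping finitely many terms makes it
  a bound for all of them and leaves the series divergent. From the first skip on,
  \<open>t\<^sub>n\<^sub>+\<^sub>1 \<le> x\<^sub>n\<close> persists. Skipping an index yields this
  bound directly; keeping the term \<open>x\<^sub>n\<close> yields
  \<open>t\<^sub>n\<^sub>+\<^sub>1 = t\<^sub>n - x\<^sub>n \<le> x\<^sub>n\<^sub>-\<^sub>1 - x\<^sub>n \<le> (1/c - 1) x\<^sub>n \<le> x\<^sub>n\<close>, and it is
  here that \<open>1/2\<close> is the critical ratio. So \<open>t\<close> tends to \<open>0\<close>, which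
  means that the kept terms add up to \<open>l\<close> and that there are infinitely many of them.
  Moreover \<open>t\<^sub>n \<le> x\<^sub>n\<^sub>-\<^sub>1 \<le> x\<^sub>n / c\<close> shows that keeping \<open>x\<^sub>n\<close> shrinks the remainder at least
  by the factor \<open>1 - c\<close>. The kept terms lie below the remainders, so from then on they decay
  geometrically, and hence all their positive powers are summable.
\<close>

primrec greedy_remainder :: "(nat \<Rightarrow> real) \<Rightarrow> real \<Rightarrow> nat \<Rightarrow> real" where
  "greedy_remainder x l 0 = l"
| "greedy_remainder x l (Suc n) =
     (if x n < greedy_remainder x l n then greedy_remainder x l n - x n
      else greedy_remainder x l n)"

definition greedy_set :: "(nat \<Rightarrow> real) \<Rightarrow> real \<Rightarrow> nat set" where
  "greedy_set x l = {n. x n < greedy_remainder x l n}"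

lemma greedy_remainder_pos: "l > 0 \<Longrightarrow> greedy_remainder x l n > 0"
  by (induction n) auto

lemma greedy_remainder_antimono:
  assumes "\<And>n. x n > 0" "m \<le> n"
  shows "greedy_remainder x l n \<le> greedy_remainder x l m"
  using assms(2)
proof (induction n rule: dec_induct)
  case (step n)
  then show ?case using assms(1)[of n] by simp
qed simp

lemma sum_greedy_set_eq:
  "(\<Sum>i<n. if i \<in> greedy_set x l then x i else 0) = l - greedy_remainder x l n"
  by (induction n) (auto simp: greedy_set_def)

text \<open>If no index were skipped, all partial sums of the series would stay below \<open>l\<close>.\<close>

lemma greedy_skips_some_index:
  assumes pos: "\<And>n. x n > 0" and div: "\<not> summable x" and l: "l > 0"
  obtains m where "m \<notin> greedy_set x l"
proof -
  have "\<exists>m. m \<notin> greedy_set x l"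
  proof (rule ccontr)
    assume "\<nexists>m. m \<notin> greedy_set x l"
    then have "(\<Sum>i<n. x i) = l - greedy_remainder x l n" for n
      using sum_greedy_set_eq[of x l n] by simp
    then have "(\<Sum>i<n. x i) \<le> l" for n
      using greedy_remainder_pos[OF l, of x n] by simp
    then have "summable x"
      using pos by (intro summableI_nonneg_bounded) (auto intro: less_imp_le)
    with div show False ..
  qed
  then show thesis using that by blast
qed

text \<open>The invariant that drives the argument. This is where the ratio \<open>1/2\<close> is critical: keeping
  \<open>x\<^sub>n\<^sub>+\<^sub>1\<close> from a remainder of at most \<open>x\<^sub>n \<le> 2 x\<^sub>n\<^sub>+\<^sub>1\<close> leaves at most \<open>x\<^sub>n\<^sub>+\<^sub>1\<close>.\<close>

lemma greedy_remainder_le_last_term: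
  assumes ratio: "\<And>n. x n \<le> 2 * x (Suc n)"
    and skip: "m \<notin> greedy_set x l" and "m \<le> n"
  shows "greedy_remainder x l (Suc n) \<le> x n"
  using \<open>m \<le> n\<close>
proof (induction n rule: dec_induct)
  case base
  then show ?case using skip by (simp add: greedy_set_def)
next
  case (step n)
  then show ?case using ratio[of n] by simp
qed

lemma greedy_remainder_tendsto_0:
  assumes ratio: "\<And>n. x n \<le> 2 * x (Suc n)" and lim: "x \<longlonglongrightarrow> 0" and l: "l > 0"
    and skip: "m \<notin> greedy_set x l"
  shows "greedy_remainder x l \<longlonglongrightarrow> 0"
proof -
  have "(\<lambda>n. greedy_remainder x l (Suc n)) \<longlonglongrightarrow> 0"
  proof (rule tendsto_sandwich[OF _ _ tendsto_const lim])
    show "\<forall>\<^sub>F n in sequentially. 0 \<le> greedy_remainder x l (Suc n)"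
      using greedy_remainder_pos[OF l] by (simp add: less_imp_le del: greedy_remainder.simps)
    show "\<forall>\<^sub>F n in sequentially. greedy_remainder x l (Suc n) \<le> x n"
      using greedy_remainder_le_last_term[OF ratio skip] eventually_sequentially by blast
  qed
  then show ?thesis by (rule LIMSEQ_imp_Suc)
qed

text \<open>A positive remainder that tends to \<open>0\<close> changes infinitely often.\<close>

lemma infinite_greedy_set:
  assumes l: "l > 0" and lim: "greedy_remainder x l \<longlonglongrightarrow> 0"
  shows "infinite (greedy_set x l)"
proof
  assume "finite (greedy_set x l)"
  then obtain b where b: "\<And>n. n \<in> greedy_set x l \<Longrightarrow> n < b"
    unfolding finite_nat_set_iff_bounded by blast
  have "greedy_remainder x l n = greedy_remainder x l b" if "b \<le> n" for n
    using that
  proof (induction n rule: dec_induct)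
    case (step n)
    then have "n \<notin> greedy_set x l" using b[of n] by auto
    with step show ?case by (simp add: greedy_set_def)
  qed simp
  then have "\<forall>\<^sub>F n in sequentially. greedy_remainder x l n = greedy_remainder x l b"
    using eventually_sequentially by blast
  then have "greedy_remainder x l \<longlonglongrightarrow> greedy_remainder x l b"
    by (rule tendsto_eventually)
  then have "greedy_remainder x l b = 0"
    using lim LIMSEQ_unique by blast
  then show False using greedy_remainder_pos[OF l, of x b] by simp
qed

text \<open>The remainder before a kept \<open>x\<^sub>n\<^sub>+\<^sub>1\<close> is at most \<open>x\<^sub>n \<le> x\<^sub>n\<^sub>+\<^sub>1 / c\<close>, so the kept term takes away at
  least the proportion \<open>c\<close> of it.\<close>

lemma greedy_remainder_contracts:
  assumes ratio: "\<And>n. c * x n \<le> x (Suc n)" and c: "c \<ge> 1 / 2" and pos: "\<And>n. x n > 0"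
    and skip: "m \<notin> greedy_set x l" and n: "n \<in> greedy_set x l" "m < n"
  shows "greedy_remainder x l (Suc n) \<le> (1 - c) * greedy_remainder x l n"
proof -
  obtain k where k: "n = Suc k" "m \<le> k"
    using n(2) by (cases n) auto
  have "x i \<le> 2 * x (Suc i)" for i
    using ratio[of i] mult_right_mono[OF c, of "x i"] pos[of i] by linarith
  then have "greedy_remainder x l n \<le> x k"
    unfolding k(1) using skip k(2) by (rule greedy_remainder_le_last_term)
  then have "c * greedy_remainder x l n \<le> c * x k"
    using c by (intro mult_left_mono) auto
  also have "\<dots> \<le> x n" using ratio[of k] k(1) by simp
  finally show ?thesis using n(1) by (simp add: greedy_set_def algebra_simps)
qed

lemma greedy_subsequence_powr_summable:
  fixes \<alpha> :: real
  assumes ratio: "\<And>n. c * x n \<le> x (Suc n)" and c: "c \<ge> 1 / 2" and pos: "\<And>n. x n > 0"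
    and l: "l > 0" and skip: "m \<notin> greedy_set x l"
    and r: "strict_mono r" "range r \<subseteq> greedy_set x l" and \<alpha>: "\<alpha> > 0"
  shows "summable (\<lambda>k. x (r k) powr \<alpha>)"
proof -
  let ?t = "greedy_remainder x l"
  have contr: "?t (r (Suc k)) \<le> (1 - c) * ?t (r k)" if "m < k" for k
  proof -
    have "?t (r (Suc k)) \<le> ?t (Suc (r k))"
      using strict_monoD[OF r(1), of k "Suc k"] by (intro greedy_remainder_antimono pos) simp
    also have "\<dots> \<le> (1 - c) * ?t (r k)"
      using r(2) that strict_mono_imp_increasing[OF r(1), of k]
      by (intro greedy_remainder_contracts[OF ratio c pos skip]) auto
    finally show ?thesis .
  qed
  \<comment> \<open>The contraction of a positive quantity already excludes \<open>c \<ge> 1\<close>.\<close>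
  have "0 < (1 - c) * ?t (r (Suc m))"
    using contr[of "Suc m"] greedy_remainder_pos[OF l, of x "r (Suc (Suc m))"] by simp
  then have c1: "c < 1"
    using greedy_remainder_pos[OF l, of x "r (Suc m)"] by (simp add: zero_less_mult_iff)
  have "summable (\<lambda>k. ?t (r k) powr \<alpha>)"
  proof (rule summable_ratio_test)
    show "(1 - c) powr \<alpha> < 1"
      using c c1 \<alpha> powr_less_mono2[of \<alpha> "1 - c" 1] by simp
    fix k assume "Suc m \<le> k"
    then have "?t (r (Suc k)) powr \<alpha> \<le> ((1 - c) * ?t (r k)) powr \<alpha>"
      using contr[of k] \<alpha> greedy_remainder_pos[OF l, of x "r (Suc k)"]
      by (intro powr_mono2) auto
    also have "\<dots> = (1 - c) powr \<alpha> * ?t (r k) powr \<alpha>"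
      by (rule powr_mult)
    finally show "norm (?t (r (Suc k)) powr \<alpha>) \<le> (1 - c) powr \<alpha> * norm (?t (r k) powr \<alpha>)"
      by simp
  qed
  then show ?thesis
  proof (rule summable_comparison_test')
    fix k
    have "r k \<in> greedy_set x l" using r(2) by blast
    then have "x (r k) \<le> ?t (r k)" by (simp add: greedy_set_def)
    then show "norm (x (r k) powr \<alpha>) \<le> ?t (r k) powr \<alpha>"
      using pos[of "r k"] \<alpha> by (simp add: powr_mono2)
  qed
qed

theorem greedy_subsequence_exists:
  fixes x :: "nat \<Rightarrow> real"
  assumes ratio: "\<And>n. c * x n \<le> x (Suc n)" and c: "c \<ge> 1 / 2" and pos: "\<And>n. x n > 0"
    and div: "\<not> summable x" and lim: "x \<longlonglongrightarrow> 0" and l: "l > 0"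
  shows "\<exists>r :: nat \<Rightarrow> nat. strict_mono r \<and> (\<lambda>k. x (r k)) sums l \<and>
           (\<forall>\<alpha>::real. \<alpha> > 0 \<longrightarrow> summable (\<lambda>k. x (r k) powr \<alpha>))"
proof -
  let ?A = "greedy_set x l"
  obtain m where skip: "m \<notin> ?A"
    using greedy_skips_some_index[OF pos div l] .
  have "x n \<le> 2 * x (Suc n)" for n
    using ratio[of n] mult_right_mono[OF c, of "x n"] pos[of n] by linarith
  then have t0: "greedy_remainder x l \<longlonglongrightarrow> 0"
    using lim l skip by (rule greedy_remainder_tendsto_0)
  have inf: "infinite ?A" using l t0 by (rule infinite_greedy_set)
  define r where "r = enumerate ?A"
  have mono: "strict_mono r" and range: "range r = ?A"
    using inf by (simp_all add: r_def strict_mono_enumerate range_enumerate)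
  have "(\<lambda>n. if n \<in> ?A then x n else 0) sums l"
    unfolding sums_def sum_greedy_set_eq using tendsto_diff[OF tendsto_const t0, of l] by simp
  then have "(\<lambda>k. if r k \<in> ?A then x (r k) else 0) sums l"
    using sums_mono_reindex[OF mono, of "\<lambda>n. if n \<in> ?A then x n else 0" l] range by simp
  moreover have "r k \<in> ?A" for k using range by blast
  ultimately have "(\<lambda>k. x (r k)) sums l" by simp
  moreover have "summable (\<lambda>k. x (r k) powr \<alpha>)" if "\<alpha> > 0" for \<alpha> :: real
    using greedy_subsequence_powr_summable[OF ratio c pos l skip mono _ that] range by simp
  ultimately show ?thesis using mono by blast
qed

theorem corollary6:
  fixes x :: "nat \<Rightarrow> real" and l :: real
  assumes "decseq x"
    and "\<And>n. x n > 0"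
    and "(\<Sum>n. ereal (x n)) = \<infinity>"
    and "x \<longlonglongrightarrow> 0"
    and "liminf (\<lambda>n. ereal (x (Suc n) / x n)) > ereal (1 / 2)"
    and "l > 0"
  shows "\<exists>r :: nat \<Rightarrow> nat. strict_mono r \<and> (\<lambda>k. x (r k)) sums l \<and>
           (\<forall>\<alpha>::real. \<alpha> > 0 \<longrightarrow> summable (\<lambda>k. x (r k) powr \<alpha>))"
proof -
  obtain c where c: "1 / 2 < c" "ereal c < liminf (\<lambda>n. ereal (x (Suc n) / x n))"
    using ereal_dense2[OF assms(5)] by auto
  have "\<forall>\<^sub>F n in sequentially. ereal c < ereal (x (Suc n) / x n)"
    using c(2) by (rule less_LiminfD)
  then obtain N where N: "\<And>n. n \<ge> N \<Longrightarrow> c < x (Suc n) / x n"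
    by (auto simp: eventually_sequentially)
  have div: "\<not> summable x"
  proof
    assume "summable x"
    then have "(\<Sum>n. ereal (x n)) \<noteq> \<infinity>"
      using suminf_ereal_finite by blast
    with assms(3) show False by contradiction
  qed
  have "\<exists>s :: nat \<Rightarrow> nat. strict_mono s \<and> (\<lambda>k. x (s k + N)) sums l \<and>
          (\<forall>\<alpha>::real. \<alpha> > 0 \<longrightarrow> summable (\<lambda>k. x (s k + N) powr \<alpha>))"
  proof (rule greedy_subsequence_exists[where x = "\<lambda>n. x (n + N)" and c = c])
    show "c * x (n + N) \<le> x (Suc n + N)" for n
      using N[of "n + N"] assms(2)[of "n + N"] by (simp add: pos_less_divide_eq)
    show "\<not> summable (\<lambda>n. x (n + N))" using div by simp
    show "(\<lambda>n. x (n + N)) \<longlonglongrightarrow> 0" using assms(4) by (rule LIMSEQ_ignore_initial_segment)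
  qed (use c assms in auto)
  then obtain s :: "nat \<Rightarrow> nat" where s: "strict_mono s" "(\<lambda>k. x (s k + N)) sums l"
      "\<And>\<alpha>::real. \<alpha> > 0 \<Longrightarrow> summable (\<lambda>k. x (s k + N) powr \<alpha>)"
    by blast
  have "strict_mono (\<lambda>k. s k + N)" using s(1) by (simp add: strict_mono_def)
  with s(2,3) show ?thesis by (intro exI[of _ "\<lambda>k. s k + N"]) simp
qed

end
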